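(* Let $Q=\begin{bmatrix}2&1\\1&1\end{bmatrix}\in \mathrm{GL}_2(\mathbb{Z})$, viewed as an automorphism of $\mathbb{Z}^2$ via $v\mapsto vQ$, and let $\mathbb{Z}^2\rtimes_Q\mathbb{Z}$ be the corresponding semidirect product, with $\mathbb{Z}^2$ regarded as a subgroup of it. Then $$\mathrm{Alg}(\mathbb{Z}^2)\neq\{K\subseteq \mathbb{Z}^2\mid K\in \mathrm{Alg}(\mathbb{Z}^2\rtimes_Q\mathbb{Z})\}.$$
   Context: For a finitely generated group $G$ with finite generating set $A$, let $\tilde A=A\cup A^{-1}$ (formal inverses) and let $\pi:\tilde A^*\to G$ be the canonical surjective monoid homomorphism. A subset $K\subseteq G$ is called algebraic if there is a context-free language $L\subseteq\tilde A^*$ with $L\pi=K$; $\mathrm{Alg}(G)$ denotes the class of algebraic subsets of $G$. (This class does not depend on the choice of finite generating set.) For a group $G=\langle A\mid R\rangle$ and $\varphi\in\mathrm{Aut}(G)$, the semidirect product is $G\rtimes_\varphi\mathbb{Z}=\langle A,t\mid R,\ t^{-1}at=a\varphi\ (a\in A)\rangle$; every element is uniquely of the form $t^kg$ with $k\in\mathbb{Z}$, $g\in G$, and $G$ is identified with $\{t^0g\mid g\in G\}$. *)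

theory Defs
  imports
    "HOL-Analysis.Cartesian_Space"
    "HOL-Algebra.Bij"
    "HOL-Algebra.Generated_Groups"
    "HOL-Algebra.Elementary_Groups"
begin

section \<open>Context-free languages\<close>

datatype ('n, 't) symb = Nt 'n | Tm 't

type_synonym ('n, 't) productions = "('n \<times> ('n, 't) symb list) set"

inductive derive_step ::
  "('n, 't) productions \<Rightarrow> ('n, 't) symb list \<Rightarrow> ('n, 't) symb list \<Rightarrow> bool"
  for P where
  "(X, w) \<in> P \<Longrightarrow> derive_step P (u @ [Nt X] @ v) (u @ w @ v)"

definition language_of :: "('n, 't) productions \<Rightarrow> 'n \<Rightarrow> 't list set" where
  "language_of P S = {w. (derive_step P)\<^sup>*\<^sup>* [Nt S] (map Tm w)}"

text \<open>Finitely many productions involve only finitely many nonterminals and terminals, so taking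
  nonterminals from \<^typ>\<open>nat\<close> is no restriction.\<close>

definition context_free :: "'t list set \<Rightarrow> bool" where
  "context_free L \<longleftrightarrow> (\<exists>(P :: (nat, 't) productions) S. finite P \<and> L = language_of P S)"


section \<open>Algebraic subsets of a group\<close>

definition finite_generating_set :: "('a, 'b) monoid_scheme \<Rightarrow> 'a set \<Rightarrow> bool" where
  "finite_generating_set G A \<longleftrightarrow> finite A \<and> A \<subseteq> carrier G \<and> generate G A = carrier G"

datatype 'a letter = Pos 'a | Neg 'a

definition letters :: "'a set \<Rightarrow> 'a letter set" where
  "letters A = Pos ` A \<union> Neg ` A"

fun letter_val :: "('a, 'b) monoid_scheme \<Rightarrow> 'a letter \<Rightarrow> 'a" where
  "letter_val G (Pos a) = a"
| "letter_val G (Neg a) = inv\<^bsub>G\<^esub> a"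

fun word_val :: "('a, 'b) monoid_scheme \<Rightarrow> 'a letter list \<Rightarrow> 'a" where
  "word_val G [] = \<one>\<^bsub>G\<^esub>"
| "word_val G (x # w) = letter_val G x \<otimes>\<^bsub>G\<^esub> word_val G w"

text \<open>For finite generating sets \<open>A\<close> of a group \<open>G\<close>, the class does not depend on \<open>A\<close>;
  the choice is nevertheless kept explicit.\<close>

definition Alg :: "('a, 'b) monoid_scheme \<Rightarrow> 'a set \<Rightarrow> 'a set set" where
  "Alg G A = {K. \<exists>L. context_free L \<and> L \<subseteq> lists (letters A) \<and> word_val G ` L = K}"


section \<open>Semidirect products with the integers\<close>

text \<open>The pair \<open>(k, g)\<close> stands for \<open>t\<^sup>k g\<close>. Since \<open>t\<^sup>-\<^sup>1 g t = \<phi> g\<close>, we have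
  \<open>t\<^sup>k g t\<^sup>l h = t\<^sup>k\<^sup>+\<^sup>l (\<phi>\<^sup>l g) h\<close>.\<close>

definition semidirect :: "('a, 'b) monoid_scheme \<Rightarrow> ('a \<Rightarrow> 'a) \<Rightarrow> (int \<times> 'a) monoid" where
  "semidirect G \<phi> =
    \<lparr>carrier = UNIV \<times> carrier G,
     mult = \<lambda>(k, g) (l, h). (k + l, (\<phi> [^]\<^bsub>AutoGroup G\<^esub> l) g \<otimes>\<^bsub>G\<^esub> h),
     one = (0, \<one>\<^bsub>G\<^esub>)\<rparr>"

definition base_embed :: "'a \<Rightarrow> int \<times> 'a" where
  "base_embed g = (0, g)"

lemma carrier_AutoGroup: "carrier (AutoGroup G) = auto G"
  by (simp add: AutoGroup_def)

lemma one_AutoGroup: "\<one>\<^bsub>AutoGroup G\<^esub> = (\<lambda>x\<in>carrier G. x)"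
  by (simp add: AutoGroup_def BijGroup_def)

lemma mult_AutoGroup_apply:
  "\<lbrakk>f \<in> auto G; h \<in> auto G; x \<in> carrier G\<rbrakk> \<Longrightarrow> (f \<otimes>\<^bsub>AutoGroup G\<^esub> h) x = f (h x)"
  by (simp add: AutoGroup_def BijGroup_def auto_def compose_def)

context group
begin

lemma auto_closed: "\<lbrakk>f \<in> auto G; x \<in> carrier G\<rbrakk> \<Longrightarrow> f x \<in> carrier G"
  by (auto simp: auto_def hom_def)

lemma auto_mult:
  "\<lbrakk>f \<in> auto G; x \<in> carrier G; y \<in> carrier G\<rbrakk> \<Longrightarrow> f (x \<otimes> y) = f x \<otimes> f y"
  by (auto simp: auto_def hom_def)

lemma auto_one: "f \<in> auto G \<Longrightarrow> f \<one> = \<one>"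
  by (metis auto_closed auto_mult l_one one_closed r_cancel_one')

lemma auto_pow_closed:
  assumes "\<phi> \<in> auto G"
  shows "\<phi> [^]\<^bsub>AutoGroup G\<^esub> (k :: int) \<in> auto G"
  using group.int_pow_closed[OF AutoGroup] assms by (simp add: carrier_AutoGroup)

lemma auto_pow_add:
  fixes k l :: int
  assumes "\<phi> \<in> auto G" "x \<in> carrier G"
  shows "(\<phi> [^]\<^bsub>AutoGroup G\<^esub> (k + l)) x =
         (\<phi> [^]\<^bsub>AutoGroup G\<^esub> l) ((\<phi> [^]\<^bsub>AutoGroup G\<^esub> k) x)"
proof -
  have "\<phi> [^]\<^bsub>AutoGroup G\<^esub> (l + k) = \<phi> [^]\<^bsub>AutoGroup G\<^esub> l \<otimes>\<^bsub>AutoGroup G\<^esub> \<phi> [^]\<^bsub>AutoGroup G\<^esub> k"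
    using group.int_pow_mult[OF AutoGroup] assms by (simp add: carrier_AutoGroup)
  then show ?thesis
    using assms by (simp add: mult_AutoGroup_apply auto_pow_closed add.commute)
qed

lemma auto_pow_1: "\<phi> \<in> auto G \<Longrightarrow> \<phi> [^]\<^bsub>AutoGroup G\<^esub> (1 :: int) = \<phi>"
  using group.int_pow_1[OF AutoGroup] by (simp add: carrier_AutoGroup)

lemma group_semidirect:
  assumes "\<phi> \<in> auto G"
  shows "group (semidirect G \<phi>)"
proof (rule groupI)
  fix x y z
  assume "x \<in> carrier (semidirect G \<phi>)" "y \<in> carrier (semidirect G \<phi>)"
    "z \<in> carrier (semidirect G \<phi>)"
  then show "x \<otimes>\<^bsub>semidirect G \<phi>\<^esub> y \<otimes>\<^bsub>semidirect G \<phi>\<^esub> z =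
             x \<otimes>\<^bsub>semidirect G \<phi>\<^esub> (y \<otimes>\<^bsub>semidirect G \<phi>\<^esub> z)"
    using assms
    by (auto simp: semidirect_def auto_closed auto_pow_closed auto_pow_add auto_mult m_assoc)
next
  fix x
  assume x: "x \<in> carrier (semidirect G \<phi>)"
  obtain k g where kg: "x = (k, g)" "g \<in> carrier G"
    using x by (auto simp: semidirect_def)
  let ?h = "(\<phi> [^]\<^bsub>AutoGroup G\<^esub> (- k)) (inv g)"
  have "(\<phi> [^]\<^bsub>AutoGroup G\<^esub> k) ?h = inv g"
    using auto_pow_add[of \<phi> "inv g" "- k" k] assms kg by (simp add: one_AutoGroup)
  then have "(- k, ?h) \<otimes>\<^bsub>semidirect G \<phi>\<^esub> x = \<one>\<^bsub>semidirect G \<phi>\<^esub>"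
    using kg by (simp add: semidirect_def)
  moreover have "(- k, ?h) \<in> carrier (semidirect G \<phi>)"
    using assms kg by (simp add: semidirect_def auto_closed auto_pow_closed)
  ultimately show "\<exists>y\<in>carrier (semidirect G \<phi>). y \<otimes>\<^bsub>semidirect G \<phi>\<^esub> x = \<one>\<^bsub>semidirect G \<phi>\<^esub>"
    by blast
qed (use assms in \<open>auto simp: semidirect_def auto_closed auto_pow_closed auto_one one_AutoGroup\<close>)

lemma base_embed_hom:
  "\<phi> \<in> auto G \<Longrightarrow> base_embed \<in> hom G (semidirect G \<phi>)"
  by (auto simp: hom_def base_embed_def semidirect_def one_AutoGroup)

lemma semidirect_t_pow:
  assumes "\<phi> \<in> auto G"
  shows "(1, \<one>) [^]\<^bsub>semidirect G \<phi>\<^esub> (k :: int) = (k, \<one>)"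
proof -
  interpret S: group "semidirect G \<phi>"
    using assms by (rule group_semidirect)
  have "(\<lambda>k. (k, \<one>)) \<in> hom integer_group (semidirect G \<phi>)"
    using assms by (auto simp: hom_def semidirect_def auto_one auto_pow_closed)
  then interpret H: group_hom integer_group "semidirect G \<phi>" "\<lambda>k. (k, \<one>)"
    by (simp add: group_hom_def group_hom_axioms_def S.is_group)
  show ?thesis
    using H.hom_int_pow[of 1 k] by simp
qed

lemma semidirect_normal_form:
  assumes "\<phi> \<in> auto G" "g \<in> carrier G"
  shows "(1, \<one>) [^]\<^bsub>semidirect G \<phi>\<^esub> (k :: int) \<otimes>\<^bsub>semidirect G \<phi>\<^esub> base_embed g = (k, g)"
  unfolding semidirect_t_pow[OF assms(1)]
  using assms by (simp add: semidirect_def base_embed_def one_AutoGroup)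

lemma semidirect_relation:
  assumes "\<phi> \<in> auto G" "g \<in> carrier G"
  shows "inv\<^bsub>semidirect G \<phi>\<^esub> (1, \<one>) \<otimes>\<^bsub>semidirect G \<phi>\<^esub> base_embed g \<otimes>\<^bsub>semidirect G \<phi>\<^esub> (1, \<one>) =
         base_embed (\<phi> g)"
proof -
  interpret S: group "semidirect G \<phi>"
    using assms(1) by (rule group_semidirect)
  have t: "(1, \<one>) \<in> carrier (semidirect G \<phi>)"
    by (simp add: semidirect_def)
  have "inv\<^bsub>semidirect G \<phi>\<^esub> (1, \<one>) = (- 1, \<one>)"
    using semidirect_t_pow[OF assms(1), of "- 1"] S.int_pow_neg[OF t, of 1] S.int_pow_1[OF t]
    by simp
  then show ?thesis
    using assms auto_pow_1[OF assms(1)]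
    by (simp add: semidirect_def base_embed_def auto_closed one_AutoGroup)
qed

lemma finite_generating_set_semidirect:
  assumes "\<phi> \<in> auto G" "finite_generating_set G A"
  shows "finite_generating_set (semidirect G \<phi>) (insert (1, \<one>) (base_embed ` A))"
proof -
  interpret S: group "semidirect G \<phi>"
    using assms(1) by (rule group_semidirect)
  interpret H: group_hom G "semidirect G \<phi>" base_embed
    using base_embed_hom[OF assms(1)]
    by (simp add: group_hom_def group_hom_axioms_def S.is_group is_group)
  let ?B = "insert (1, \<one>) (base_embed ` A)"
  have A: "finite A" "A \<subseteq> carrier G" "generate G A = carrier G"
    using assms(2) by (auto simp: finite_generating_set_def)
  have B: "?B \<subseteq> carrier (semidirect G \<phi>)"
    using A by (auto simp: semidirect_def base_embed_def)
  have sub: "subgroup (generate (semidirect G \<phi>) ?B) (semidirect G \<phi>)"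
    using B by (rule S.generate_is_subgroup)
  have t: "(1, \<one>) \<in> generate (semidirect G \<phi>) ?B"
    by (rule generate.incl) simp
  have "base_embed g \<in> generate (semidirect G \<phi>) ?B" if "g \<in> carrier G" for g
    using H.generate_img[OF A(2)] A(3) that S.mono_generate[of "base_embed ` A" ?B] by blast
  then have "(k, g) \<in> generate (semidirect G \<phi>) ?B" if "g \<in> carrier G" for k g
    using semidirect_normal_form[OF assms(1) that, of k] that
      S.subgroup_int_pow_closed[OF sub t, of k] subgroup.m_closed[OF sub]
    by metis
  then have "generate (semidirect G \<phi>) ?B = carrier (semidirect G \<phi>)"
    using S.generate_incl[OF B] by (auto simp: semidirect_def)
  then show ?thesis
    using A(1) B by (simp add: finite_generating_set_def)
qed

end


section \<open>The group \<open>\<int>\<^sup>2\<close> and the automorphism given by \<open>Q\<close>\<close>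

definition Z2 :: "(int ^ 2) monoid" where
  "Z2 = \<lparr>carrier = UNIV, mult = (+), one = 0\<rparr>"

definition Q :: "int ^ 2 ^ 2" where
  "Q = vector [vector [2, 1], vector [1, 1]]"

definition Q_aut :: "int ^ 2 \<Rightarrow> int ^ 2" where
  "Q_aut v = v v* Q"

lemma group_Z2: "group Z2"
  by (rule groupI) (auto simp: Z2_def intro: exI[of _ "- _"] left_minus)

lemma Q_aut_nth: "Q_aut v $ 1 = 2 * v $ 1 + v $ 2" "Q_aut v $ 2 = v $ 1 + v $ 2"
  by (simp_all add: Q_aut_def Q_def vector_matrix_mult_def sum_2)

lemma Q_aut_auto: "Q_aut \<in> auto Z2"
proof -
  have "bij Q_aut"
  proof (rule bijI)
    show "inj Q_aut"
      by (auto simp: inj_def vec_eq_iff forall_2 Q_aut_nth)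
    have "Q_aut (vector [w $ 1 - w $ 2, 2 * w $ 2 - w $ 1]) = w" for w
      by (simp add: vec_eq_iff forall_2 Q_aut_nth)
    then show "surj Q_aut"
      by (rule surjI)
  qed
  then show ?thesis
    by (auto simp: auto_def Bij_def hom_def Z2_def vec_eq_iff forall_2 Q_aut_nth)
qed

lemma finite_generating_set_Z2: "finite_generating_set Z2 {axis 1 1, axis 2 1}"
proof -
  interpret group Z2
    by (rule group_Z2)
  let ?A = "{axis 1 1, axis 2 1} :: (int ^ 2) set"
  have sub: "subgroup (generate Z2 ?A) Z2"
    by (rule generate_is_subgroup) (simp add: Z2_def)
  have pow: "x [^]\<^bsub>Z2\<^esub> (k :: int) = k *s x" for x k
  proof -
    have "(\<lambda>k. k *s x) \<in> hom integer_group Z2"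
      by (auto simp: hom_def Z2_def vec_eq_iff algebra_simps)
    then interpret H: group_hom integer_group Z2 "\<lambda>k. k *s x"
      by (simp add: group_hom_def group_hom_axioms_def is_group)
    show ?thesis
      using H.hom_int_pow[of 1 k] by simp
  qed
  have "v \<in> generate Z2 ?A" for v
  proof -
    have "axis 1 1 [^]\<^bsub>Z2\<^esub> (v $ 1) \<otimes>\<^bsub>Z2\<^esub> axis 2 1 [^]\<^bsub>Z2\<^esub> (v $ 2) \<in> generate Z2 ?A"
      by (intro subgroup.m_closed[OF sub] subgroup_int_pow_closed[OF sub] generate.incl) auto
    moreover have "axis 1 1 [^]\<^bsub>Z2\<^esub> (v $ 1) \<otimes>\<^bsub>Z2\<^esub> axis 2 1 [^]\<^bsub>Z2\<^esub> (v $ 2) = v"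
      unfolding pow by (simp add: Z2_def vec_eq_iff forall_2 axis_def)
    ultimately show ?thesis
      by simp
  qed
  then show ?thesis
    by (auto simp: finite_generating_set_def Z2_def)
qed

end

theory Submission
  imports Defs
begin

text \<open>
  The orbit \<open>K = {e\<^sub>1 Q\<^sup>n | n \<ge> 0}\<close> separates the two classes. It is the image of the context-free
  language \<open>{t\<^sup>-\<^sup>n e\<^sub>1 t\<^sup>n | n \<ge> 0}\<close>, hence algebraic in the semidirect product. In a commutative
  monoid, on the other hand, every infinite image of a context-free language contains a
  nonconstant three-term arithmetic progression: take a derivation tree of minimal size among those
  with the same value. If a nonterminal repeats on some path, cutting out or doubling the part between
  the two occurrences gives a progression, which is nonconstant by minimality; and there are only
  finitely many trees without such a repetition. Since the first coordinate at least doubles along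
  the orbit, \<open>K\<close> contains no such progression.
\<close>

section \<open>Values of context-free languages in commutative monoids\<close>

text \<open>One derivation tree for each symbol of the list. The trees are recorded only through
  their size \<open>n\<close>, the number of productions applied, and their value \<open>v\<close>,
  the sum over all leaves.\<close>

inductive forest ::
  "('n, 't) productions \<Rightarrow> ('t \<Rightarrow> 'g :: comm_monoid_add) \<Rightarrow> nat \<Rightarrow> ('n, 't) symb list \<Rightarrow> 'g \<Rightarrow> bool"
  for P f where
  Nil: "forest P f 0 [] 0"
| Tm: "forest P f n w v \<Longrightarrow> forest P f n (Tm a # w) (f a + v)"
| Nt: "(X, \<gamma>) \<in> P \<Longrightarrow> forest P f n \<gamma> v \<Longrightarrow> forest P f m w v' \<Longrightarrow>
    forest P f (Suc (n + m)) (Nt X # w) (v + v')"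

inductive_cases forest_NilE: "forest P f n [] v"
inductive_cases forest_TmE: "forest P f n (Tm a # w) v"
inductive_cases forest_NtE: "forest P f n (Nt X # w) v"

lemma forest_append:
  "forest P f n u v \<Longrightarrow> forest P f m w v' \<Longrightarrow> forest P f (n + m) (u @ w) (v + v')"
proof (induction rule: forest.induct)
  case (Tm n u v a)
  then show ?case
    using forest.Tm[of P f "n + m" "u @ w" "v + v'" a] by (simp add: add.assoc)
next
  case (Nt X \<gamma> n v k u v'')
  then show ?case
    using forest.Nt[OF Nt.hyps(1,2), of "k + m" "u @ w" "v'' + v'"] by (simp add: add.assoc)
qed simp

lemma forest_append_split:
  "forest P f n (u @ w) v \<Longrightarrow>
    \<exists>n1 n2 v1 v2. forest P f n1 u v1 \<and> forest P f n2 w v2 \<and> n = n1 + n2 \<and> v = v1 + v2"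
proof (induction u arbitrary: n v)
  case Nil
  then show ?case
    using forest.Nil[of P f] by force
next
  case (Cons x u)
  show ?case
  proof (cases x)
    case (Nt X)
    obtain \<gamma> k v1 m v2 where *: "(X, \<gamma>) \<in> P" "forest P f k \<gamma> v1" "forest P f m (u @ w) v2"
      "n = Suc (k + m)" "v = v1 + v2"
      using Cons.prems Nt by (auto elim: forest_NtE)
    obtain n1 n2 v3 v4 where "forest P f n1 u v3" "forest P f n2 w v4" "m = n1 + n2" "v2 = v3 + v4"
      using Cons.IH[OF *(3)] by blast
    with * Nt show ?thesis
      using forest.Nt[OF *(1,2), of n1 u v3]
      by (intro exI[of _ "Suc (k + n1)"] exI[of _ n2] exI[of _ "v1 + v3"] exI[of _ v4])
         (simp add: add.assoc)
  next
    case (Tm a)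
    obtain v1 where *: "forest P f n (u @ w) v1" "v = f a + v1"
      using Cons.prems Tm by (auto elim: forest_TmE)
    obtain n1 n2 v3 v4 where "forest P f n1 u v3" "forest P f n2 w v4" "n = n1 + n2" "v1 = v3 + v4"
      using Cons.IH[OF *(1)] by blast
    with * Tm show ?thesis
      using forest.Tm[of P f n1 u v3 a]
      by (intro exI[of _ n1] exI[of _ n2] exI[of _ "f a + v3"] exI[of _ v4]) (simp add: add.assoc)
  qed
qed

section \<open>Forests versus derivations\<close>

lemma forest_map_Tm: "forest P f 0 (map Tm w) (sum_list (map f w))"
  by (induction w) (auto intro: forest.intros)

text \<open>The part of the forest that stands over the right-hand side of the production is cut out
  and put under a new root \<open>X\<close>. This leaves the value unchanged, so derivations can be
  traced back from their terminal word.\<close>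

lemma derive_step_imp_forest:
  assumes "derive_step P u w" "forest P f n w v"
  shows "\<exists>m. forest P f m u v"
  using assms(1)
proof cases
  case (1 X \<gamma> x y)
  then obtain n1 n2 v1 v2 where 2: "forest P f n1 x v1" "forest P f n2 (\<gamma> @ y) v2" "v = v1 + v2"
    using assms(2) forest_append_split[of P f n x "\<gamma> @ y" v] by blast
  then obtain n3 n4 v3 v4 where 3: "forest P f n3 \<gamma> v3" "forest P f n4 y v4" "v2 = v3 + v4"
    using forest_append_split[of P f n2 \<gamma> y v2] by blast
  have "forest P f (Suc (n3 + n4)) (Nt X # y) (v3 + v4)"
    by (rule forest.Nt) (use 1 3 in auto)
  from forest_append[OF 2(1) this] show ?thesis
    using 1 2 3 by auto
qed

lemma derives_imp_forest:
  assumes "(derive_step P)\<^sup>*\<^sup>* u (map Tm w)"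
  shows "\<exists>n. forest P f n u (sum_list (map f w))"
  using assms
  by (induction rule: converse_rtranclp_induct)
     (blast intro: forest_map_Tm derive_step_imp_forest)+

lemma derive_step_append: "derive_step P u w \<Longrightarrow> derive_step P (x @ u @ y) (x @ w @ y)"
proof (induction rule: derive_step.induct)
  case (1 X w u v)
  from derive_step.intros[OF this, of "x @ u" "v @ y"] show ?case
    by simp
qed

lemma derives_append:
  "(derive_step P)\<^sup>*\<^sup>* u w \<Longrightarrow> (derive_step P)\<^sup>*\<^sup>* (x @ u @ y) (x @ w @ y)"
  by (induction rule: rtranclp_induct) (auto intro: derive_step_append rtranclp.rtrancl_into_rtrancl)

lemma forest_imp_derives:
  "forest P f n u v \<Longrightarrow> \<exists>w. (derive_step P)\<^sup>*\<^sup>* u (map Tm w) \<and> sum_list (map f w) = v"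
proof (induction rule: forest.induct)
  case Nil
  then show ?case
    by (intro exI[of _ "[]"]) simp
next
  case (Tm n w v a)
  then obtain z where "(derive_step P)\<^sup>*\<^sup>* w (map Tm z)" "sum_list (map f z) = v"
    by blast
  then show ?case
    using derives_append[of P w "map Tm z" "[Tm a]" "[]"] by (intro exI[of _ "a # z"]) simp
next
  case (Nt X \<gamma> n v m w v')
  then obtain y z where y: "(derive_step P)\<^sup>*\<^sup>* \<gamma> (map Tm y)" "sum_list (map f y) = v"
    and z: "(derive_step P)\<^sup>*\<^sup>* w (map Tm z)" "sum_list (map f z) = v'"
    by blast
  have "derive_step P (Nt X # w) (\<gamma> @ w)"
    using derive_step.intros[OF Nt.hyps(1), of "[]" w] by simp
  also have "(derive_step P)\<^sup>*\<^sup>* (\<gamma> @ w) (map Tm y @ w)"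
    using derives_append[OF y(1), of "[]" w] by simp
  also have "(derive_step P)\<^sup>*\<^sup>* (map Tm y @ w) (map Tm y @ map Tm z)"
    using derives_append[OF z(1), of "map Tm y" "[]"] by simp
  finally show ?case
    using y z by (intro exI[of _ "y @ z"]) simp
qed

lemma values_language_of:
  "(\<lambda>w. sum_list (map f w)) ` language_of P S = {v. \<exists>n. forest P f n [Nt S] v}"
  by (auto simp: language_of_def dest: derives_imp_forest[of P _ _ f] forest_imp_derives)

text \<open>\<open>U\<close> collects the nonterminals on the path from the root.\<close>

inductive acyclic_forest ::
  "('n, 't) productions \<Rightarrow> ('t \<Rightarrow> 'g :: comm_monoid_add) \<Rightarrow> 'n set \<Rightarrow> ('n, 't) symb list \<Rightarrow> 'g \<Rightarrow> bool"
  for P f where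
  Nil: "acyclic_forest P f U [] 0"
| Tm: "acyclic_forest P f U w v \<Longrightarrow> acyclic_forest P f U (Tm a # w) (f a + v)"
| Nt: "(X, \<gamma>) \<in> P \<Longrightarrow> X \<notin> U \<Longrightarrow> acyclic_forest P f (insert X U) \<gamma> v \<Longrightarrow>
    acyclic_forest P f U w v' \<Longrightarrow> acyclic_forest P f U (Nt X # w) (v + v')"

inductive_cases acyclic_forest_NilE: "acyclic_forest P f U [] v"
inductive_cases acyclic_forest_TmE: "acyclic_forest P f U (Tm a # w) v"
inductive_cases acyclic_forest_NtE: "acyclic_forest P f U (Nt X # w) v"

text \<open>Depth is bounded: each descent below a nonterminal adds it to \<open>U\<close>, so fewer
  left-hand sides of productions stay outside \<open>U\<close>. The outer induction is on their
  number, the inner one runs through the siblings in \<open>w\<close>.\<close>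

lemma finite_acyclic_forest_values:
  assumes "finite P"
  shows "finite {v. acyclic_forest P f U w v}"
proof (induction "card (fst ` P - U)" arbitrary: U w rule: less_induct)
  case less
  note outer = less
  show ?case
  proof (induction w)
    case Nil
    have "{v. acyclic_forest P f U [] v} \<subseteq> {0}"
      by (auto elim: acyclic_forest_NilE)
    then show ?case
      by (rule finite_subset) simp
  next
    case (Cons x w)
    show ?case
    proof (cases x)
      case (Tm a)
      have "{v. acyclic_forest P f U (x # w) v} \<subseteq> (+) (f a) ` {v. acyclic_forest P f U w v}"
        using Tm by (auto elim: acyclic_forest_TmE)
      then show ?thesis
        by (rule finite_subset) (use Cons in simp)
    next
      case (Nt X)
      have fin: "finite {v. acyclic_forest P f (insert X U) \<gamma> v}" if "(X, \<gamma>) \<in> P" "X \<notin> U" for \<gamma>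
      proof (rule outer)
        have "X \<in> fst ` P"
          using that by force
        then show "card (fst ` P - insert X U) < card (fst ` P - U)"
          using that assms by (intro psubset_card_mono) auto
      qed
      show ?thesis
      proof (cases "X \<in> U")
        case True
        then have "{v. acyclic_forest P f U (x # w) v} = {}"
          using Nt by (auto elim: acyclic_forest_NtE)
        then show ?thesis
          by simp
      next
        case False
        \<comment> \<open>The possible values of a tree with root \<open>X\<close>: one finite set,
          by \<open>fin\<close>, for each of the finitely many productions of
          \<open>X\<close>.\<close>
        let ?V = "\<Union>(Y, \<gamma>) \<in> {p \<in> P. fst p = X}. {v. acyclic_forest P f (insert X U) \<gamma> v}"
        have "{v. acyclic_forest P f U (x # w) v} \<subseteq>
            (\<lambda>(v, v'). v + v') ` (?V \<times> {v. acyclic_forest P f U w v})"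
          using Nt by (fastforce elim: acyclic_forest_NtE)
        moreover have "finite ?V"
          using assms fin False by auto
        ultimately show ?thesis
          using Cons by (meson finite_SigmaI finite_imageI finite_subset)
      qed
    qed
  qed
qed

section \<open>Trees with a hole, and pumping\<close>

text \<open>A tree with root \<open>X\<close> and a hole for a forest over \<open>w\<close>;
  \<open>c\<close> and \<open>s\<close> are the value and size of what surrounds the hole. Encoding
  it as a map on forests makes pumping plain composition.\<close>

definition forest_context ::
  "('n, 't) productions \<Rightarrow> ('t \<Rightarrow> 'g :: comm_monoid_add) \<Rightarrow> 'n \<Rightarrow> ('n, 't) symb list \<Rightarrow> 'g \<Rightarrow> nat \<Rightarrow> bool"
  where
  "forest_context P f X w c s \<longleftrightarrow>
    (\<forall>n v. forest P f n w v \<longrightarrow> forest P f (s + n) [Nt X] (c + v))"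

lemma forest_contextD:
  "forest_context P f X w c s \<Longrightarrow> forest P f n w v \<Longrightarrow> forest P f (s + n) [Nt X] (c + v)"
  by (simp add: forest_context_def)

lemma forest_context_Tm:
  assumes "forest_context P f X (Tm a # w) c s"
  shows "forest_context P f X w (c + f a) s"
  unfolding forest_context_def
  using forest_contextD[OF assms forest.Tm] by (auto simp: add.assoc)

lemma forest_context_append_left:
  assumes "forest_context P f X (u @ w) c s" "forest P f n u v"
  shows "forest_context P f X w (c + v) (s + n)"
  unfolding forest_context_def
  using forest_contextD[OF assms(1) forest_append[OF assms(2)]] by (auto simp: add.assoc)

text \<open>Commutativity enters here: the value filled in to the right of the remaining hole is
  moved to its left.\<close>

lemma forest_context_append_right:
  assumes "forest_context P f X (u @ w) c s" "forest P f n w v"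
  shows "forest_context P f X u (c + v) (s + n)"
  unfolding forest_context_def
  using forest_contextD[OF assms(1) forest_append[OF _ assms(2)]]
  by (auto simp: add.assoc add.left_commute add.commute)

lemma forest_production:
  assumes "(X, \<gamma>) \<in> P" "forest P f n \<gamma> v"
  shows "forest P f (Suc n) [Nt X] v"
  using forest.Nt[OF assms forest.Nil] by simp

lemma forest_context_production:
  assumes "forest_context P f Y [Nt X] c s" "(X, \<gamma>) \<in> P"
  shows "forest_context P f Y \<gamma> c (Suc s)"
  unfolding forest_context_def
proof (intro allI impI)
  fix n v
  assume "forest P f n \<gamma> v"
  from forest_contextD[OF assms(1) forest_production[OF assms(2) this]]
  show "forest P f (Suc s + n) [Nt Y] (c + v)"
    by simp
qed

text \<open>The induction walks through a smallest tree of value \<open>k\<close>. The context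
  \<open>c0\<close>, \<open>s0\<close> is everything outside the current forest, and for each
  ancestor \<open>Y\<close> in \<open>U\<close> it factors as a context from \<open>S\<close> to
  \<open>Y\<close> followed by a nonempty one from \<open>Y\<close> to the hole. Nonemptiness makes
  cutting out a repetition shrink the tree.\<close>

lemma minimal_forest_acyclic:
  assumes "forest P f n w v"
    and minimal: "\<And>m. forest P f m [Nt S] k \<Longrightarrow> N \<le> m"
    and no_progression: "\<And>p d. \<exists>n. forest P f n [Nt S] p \<Longrightarrow> \<exists>n. forest P f n [Nt S] (p + d) \<Longrightarrow>
      \<exists>n. forest P f n [Nt S] (p + d + d) \<Longrightarrow> d = 0"
    and "forest_context P f S w c0 s0" "c0 + v = k" "s0 + n = N"
    and "\<And>Y. Y \<in> U \<Longrightarrow> \<exists>c1 s1 c s. forest_context P f S [Nt Y] c1 s1 \<and> forest_context P f Y w c s \<and>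
      c1 + c = c0 \<and> s1 + s = s0 \<and> 0 < s"
  shows "acyclic_forest P f U w v"
  using assms(1,4-)
proof (induction arbitrary: U c0 s0 rule: forest.induct)
  case Nil
  show ?case
    by (rule acyclic_forest.Nil)
next
  case (Tm n w v a)
  show ?case
  proof (rule acyclic_forest.Tm, rule Tm.IH)
    show "forest_context P f S w (c0 + f a) s0"
      using Tm.prems(1) by (rule forest_context_Tm)
    show "\<exists>c1 s1 c s. forest_context P f S [Nt Y] c1 s1 \<and> forest_context P f Y w c s \<and>
        c1 + c = c0 + f a \<and> s1 + s = s0 \<and> 0 < s" if "Y \<in> U" for Y
    proof -
      obtain c1 s1 c s where *: "forest_context P f S [Nt Y] c1 s1"
        "forest_context P f Y (Tm a # w) c s" "c1 + c = c0" "s1 + s = s0" "0 < s"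
        using Tm.prems(4)[OF \<open>Y \<in> U\<close>] by blast
      then show ?thesis
        using forest_context_Tm[OF *(2)]
        by (intro exI[of _ c1] exI[of _ s1] exI[of _ "c + f a"] exI[of _ s])
           (auto simp: add.assoc)
    qed
  qed (use Tm.prems in \<open>auto simp: add.assoc\<close>)
next
  case (Nt X \<gamma> n v m w v')
  have root: "forest P f (Suc n) [Nt X] v"
    using Nt.hyps(1,2) by (rule forest_production)
  have "X \<notin> U"
  proof
    assume "X \<in> U"
    then obtain c1 s1 c s where c1: "forest_context P f S [Nt X] c1 s1"
      and c: "forest_context P f X (Nt X # w) c s"
      and eqs: "c1 + c = c0" "s1 + s = s0" "0 < s"
      using Nt.prems(4) by blast
    \<comment> \<open>Filling in the right siblings \<open>w\<close> leaves the segment between two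
      occurrences of \<open>X\<close> on one path.\<close>
    have pump: "forest_context P f X [Nt X] (c + v') (s + m)"
      using forest_context_append_right[of P f X "[Nt X]" w] c Nt.hyps(3) by simp
    let ?d = "c + v'"
    \<comment> \<open>The segment is used zero times, once and twice, which gives three values with
      common difference \<open>?d\<close>.\<close>
    have t0: "forest P f (s1 + Suc n) [Nt S] (c1 + v)"
      using forest_contextD[OF c1 root] .
    have t1: "\<exists>n. forest P f n [Nt S] (c1 + v + ?d)"
      using forest_contextD[OF c1 forest_contextD[OF pump root]] by (auto simp: ac_simps)
    have t2: "\<exists>n. forest P f n [Nt S] (c1 + v + ?d + ?d)"
      using forest_contextD[OF c1 forest_contextD[OF pump forest_contextD[OF pump root]]]
      by (auto simp: ac_simps)
    have "?d = 0"
      using no_progression t0 t1 t2 by blast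
    \<comment> \<open>The original tree uses the segment once. As \<open>?d = 0\<close>, the cut
      tree also has value \<open>k\<close>, but it is smaller since \<open>0 < s\<close>.\<close>
    moreover have "k = c1 + v + ?d"
      unfolding Nt.prems(2)[symmetric] eqs(1)[symmetric] by (simp add: ac_simps)
    ultimately have "N \<le> s1 + Suc n"
      using minimal[of "s1 + Suc n"] t0 by simp
    then show False
      using Nt.prems(3) eqs by simp
  qed
  moreover have "acyclic_forest P f (insert X U) \<gamma> v"
  proof (rule Nt.IH(1))
    have at_X: "forest_context P f Y [Nt X] (c + v') (s + m)"
      if "forest_context P f Y (Nt X # w) c s" for Y c s
      using forest_context_append_right[of P f Y "[Nt X]" w] that Nt.hyps(3) by simp
    show "forest_context P f S \<gamma> (c0 + v') (Suc (s0 + m))"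
      using at_X[OF Nt.prems(1)] Nt.hyps(1) by (rule forest_context_production)
    show "\<exists>c1 s1 c s. forest_context P f S [Nt Y] c1 s1 \<and> forest_context P f Y \<gamma> c s \<and>
        c1 + c = c0 + v' \<and> s1 + s = Suc (s0 + m) \<and> 0 < s" if "Y \<in> insert X U" for Y
    proof (cases "Y = X")
      case True
      \<comment> \<open>For the new ancestor \<open>X\<close> itself, the inner context is the bare
        production, of size one.\<close>
      have "forest_context P f X \<gamma> 0 (Suc 0)"
        unfolding forest_context_def using forest_production[OF Nt.hyps(1)] by simp blast
      then show ?thesis
        using at_X[OF Nt.prems(1)] True
        by (intro exI[of _ "c0 + v'"] exI[of _ "s0 + m"] exI[of _ 0] exI[of _ "Suc 0"]) simp
    next
      case False
      then obtain c1 s1 c s where *: "forest_context P f S [Nt Y] c1 s1"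
        "forest_context P f Y (Nt X # w) c s" "c1 + c = c0" "s1 + s = s0" "0 < s"
        using Nt.prems(4) \<open>Y \<in> insert X U\<close> by blast
      then show ?thesis
        using forest_context_production[OF at_X[OF *(2)] Nt.hyps(1)]
        by (intro exI[of _ c1] exI[of _ s1] exI[of _ "c + v'"] exI[of _ "Suc (s + m)"])
           (auto simp: add.assoc)
    qed
  qed (use Nt.prems in \<open>auto simp: ac_simps\<close>)
  moreover have "acyclic_forest P f U w v'"
  proof (rule Nt.IH(2))
    \<comment> \<open>The siblings to the right see the finished tree at \<open>X\<close> as part of
      their context. Their ancestors are still those in \<open>U\<close>, since \<open>X\<close> is
      not above them.\<close>
    have at_w: "forest_context P f Y w (c + v) (s + Suc n)"
      if "forest_context P f Y (Nt X # w) c s" for Y c s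
      using forest_context_append_left[OF _ root, of Y w c s] that by simp
    then show "forest_context P f S w (c0 + v) (s0 + Suc n)"
      using Nt.prems(1) .
    show "\<exists>c1 s1 c s. forest_context P f S [Nt Y] c1 s1 \<and> forest_context P f Y w c s \<and>
        c1 + c = c0 + v \<and> s1 + s = s0 + Suc n \<and> 0 < s" if "Y \<in> U" for Y
    proof -
      obtain c1 s1 c s where *: "forest_context P f S [Nt Y] c1 s1"
        "forest_context P f Y (Nt X # w) c s" "c1 + c = c0" "s1 + s = s0" "0 < s"
        using Nt.prems(4)[OF \<open>Y \<in> U\<close>] by blast
      then show ?thesis
        using at_w[OF *(2)]
        by (intro exI[of _ c1] exI[of _ s1] exI[of _ "c + v"] exI[of _ "s + Suc n"])
           (auto simp: add.assoc)
    qed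
  qed (use Nt.prems in \<open>auto simp: ac_simps\<close>)
  ultimately show ?case
    using Nt.hyps(1) by (intro acyclic_forest.Nt)
qed

lemma infinite_context_free_values_progression:
  fixes f :: "'t \<Rightarrow> 'g :: comm_monoid_add"
  assumes "context_free L" and "(\<lambda>w. sum_list (map f w)) ` L = K" and "infinite K"
  obtains p d where "d \<noteq> 0" "p \<in> K" "p + d \<in> K" "p + d + d \<in> K"
proof (rule ccontr)
  note progression = that
  assume no_progression: "\<not> thesis"
  obtain P :: "(nat, 't) productions" and S where "finite P" "L = language_of P S"
    using assms(1) by (auto simp: context_free_def)
  with assms(2) have K: "K = {v. \<exists>n. forest P f n [Nt S] v}"
    by (simp add: values_language_of)
  have "acyclic_forest P f {} [Nt S] k" if "k \<in> K" for k
  proof -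
    let ?N = "LEAST n. forest P f n [Nt S] k"
    have "forest P f ?N [Nt S] k"
      using that unfolding K by (auto intro!: LeastI_ex[of "\<lambda>n. forest P f n [Nt S] k"])
    then show ?thesis
    proof (rule minimal_forest_acyclic)
      show "?N \<le> m" if "forest P f m [Nt S] k" for m
        using that by (rule Least_le)
      show "d = 0" if "\<exists>n. forest P f n [Nt S] p" "\<exists>n. forest P f n [Nt S] (p + d)"
        "\<exists>n. forest P f n [Nt S] (p + d + d)" for p d
        using that no_progression progression[of d p] unfolding K mem_Collect_eq by blast
      \<comment> \<open>At the root the context is empty and there are no ancestors yet.\<close>
      show "forest_context P f S [Nt S] 0 0"
        by (simp add: forest_context_def)
    qed auto
  qed
  then have "finite K"
    by (intro finite_subset[OF _ finite_acyclic_forest_values[OF \<open>finite P\<close>]]) auto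
  then show False
    using assms(3) by contradiction
qed


section \<open>Words and generators\<close>

context group
begin

lemma letter_val_closed: "A \<subseteq> carrier G \<Longrightarrow> x \<in> letters A \<Longrightarrow> letter_val G x \<in> carrier G"
  by (auto simp: letters_def)

lemma word_val_closed:
  "A \<subseteq> carrier G \<Longrightarrow> w \<in> lists (letters A) \<Longrightarrow> word_val G w \<in> carrier G"
  by (induction w) (auto simp: letter_val_closed)

lemma word_val_append:
  assumes "A \<subseteq> carrier G"
  shows "u \<in> lists (letters A) \<Longrightarrow> w \<in> lists (letters A) \<Longrightarrow>
    word_val G (u @ w) = word_val G u \<otimes> word_val G w"
  by (induction u)
     (auto simp: letter_val_closed[OF assms] word_val_closed[OF assms] m_assoc)

text \<open>Supplies words for chosen group elements over an arbitrary generating set, so no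
  particular generators have to be fixed.\<close>

lemma generate_word_val:
  assumes "A \<subseteq> carrier G" "g \<in> generate G A"
  shows "\<exists>w \<in> lists (letters A). word_val G w = g"
  using assms(2)
proof (induction rule: generate.induct)
  case one
  show ?case
    by (intro bexI[of _ "[]"]) auto
next
  case (incl h)
  then show ?case
    using assms(1) by (intro bexI[of _ "[Pos h]"]) (auto simp: letters_def)
next
  case (inv h)
  then show ?case
    using assms(1) by (intro bexI[of _ "[Neg h]"]) (auto simp: letters_def)
next
  case (eng h1 h2)
  then show ?case
    using word_val_append[OF assms(1)] by (metis append_in_lists_conv)
qed

end

text \<open>Translates evaluation in \<open>Z2\<close> into the additive form of the progression
  result, with \<open>f = letter_val Z2\<close>.\<close>

lemma word_val_Z2: "word_val Z2 w = sum_list (map (letter_val Z2) w)"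
  by (induction w) (auto simp: Z2_def)


section \<open>The orbit of a vector under an automorphism\<close>

definition bracket_productions :: "'t list \<Rightarrow> 't list \<Rightarrow> 't list \<Rightarrow> (nat, 't) productions" where
  "bracket_productions u w v =
    {(0, map Tm u @ [Nt 0] @ map Tm v), (0, map Tm w)}"

lemma concat_replicate_Suc_right:
  "concat (replicate (Suc n) v) = concat (replicate n v) @ v"
  by (induction n) auto

text \<open>With only terminals around a single nonterminal, the position of a rewriting step is
  forced.\<close>

lemma Nt_append_map_Tm_eq:
  "x @ [Nt X] @ y = map Tm u @ [Nt Z] @ map Tm v \<longleftrightarrow> x = map Tm u \<and> X = Z \<and> y = map Tm v"
proof
  assume eq: "x @ [Nt X] @ y = map Tm u @ [Nt Z] @ map Tm v"
  have "Nt X \<in> set (map Tm u @ [Nt Z] @ map Tm v)"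
    by (subst eq[symmetric]) simp
  then have "X = Z"
    by auto
  moreover have "Nt Z \<notin> set (map Tm u)" "Nt Z \<notin> set (map Tm v)"
    by auto
  ultimately show "x = map Tm u \<and> X = Z \<and> y = map Tm v"
    using eq append_Cons_eq_iff[of "Nt Z" "map Tm u" "map Tm v" x y] by auto
qed auto

lemma language_of_bracket_productions:
  "language_of (bracket_productions u w v) 0 =
    range (\<lambda>n. concat (replicate n u) @ w @ concat (replicate n v))"
proof -
  let ?P = "bracket_productions u w v"
  let ?open = "\<lambda>n. map Tm (concat (replicate n u)) @ [Nt (0 :: nat)] @ map Tm (concat (replicate n v))"
  let ?closed = "\<lambda>n. map Tm (concat (replicate n u) @ w @ concat (replicate n v))"
  \<comment> \<open>The new copies of \<open>u\<close> and \<open>v\<close> must appear next to the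
    nonterminal. For \<open>v\<close> this is the usual unfolding of \<open>replicate\<close>; for
    \<open>u\<close> the extra copy has to be split off on the right.\<close>
  have open_Suc: "?open (Suc n) = map Tm (concat (replicate n u)) @
      (map Tm u @ [Nt 0] @ map Tm v) @ map Tm (concat (replicate n v))" for n
    unfolding concat_replicate_Suc_right[of n u] by simp
  have grow: "derive_step ?P (?open n) (?open (Suc n))" for n
    unfolding open_Suc by (rule derive_step.intros) (simp add: bracket_productions_def)
  have stop: "derive_step ?P (?open n) (?closed n)" for n
    using derive_step.intros[of 0 "map Tm w" ?P
        "map Tm (concat (replicate n u))" "map Tm (concat (replicate n v))"]
    by (simp add: bracket_productions_def)
  have "(derive_step ?P)\<^sup>*\<^sup>* [Nt 0] (?open n)" for n
    by (induction n) (use grow in \<open>auto intro: rtranclp.rtrancl_into_rtrancl\<close>)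
  then have closed: "(derive_step ?P)\<^sup>*\<^sup>* [Nt 0] (?closed n)" for n
    using stop rtranclp.rtrancl_into_rtrancl by metis
  have shape: "(\<exists>n. z = ?open n) \<or> (\<exists>n. z = ?closed n)" if "(derive_step ?P)\<^sup>*\<^sup>* [Nt 0] z" for z
    using that
  proof (induction rule: rtranclp_induct)
    case base
    show ?case
      by (intro disjI1 exI[of _ 0]) simp
  next
    case (step y z)
    from step.hyps(2) obtain X \<gamma> a b where X: "(X, \<gamma>) \<in> ?P" "y = a @ [Nt X] @ b" "z = a @ \<gamma> @ b"
      by cases auto
    \<comment> \<open>Closed forms contain no nonterminal, so a further step can only start from an
      open one.\<close>
    have "y \<noteq> ?closed n" for n
    proof
      assume "y = ?closed n"
      then have "Nt X \<in> set (?closed n)"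
        using X(2) by (metis append_Cons in_set_conv_decomp)
      then show False
        by auto
    qed
    then obtain n where "a @ [Nt X] @ b = ?open n"
      using step.IH X(2) by auto
    then have ab: "a = map Tm (concat (replicate n u))" "b = map Tm (concat (replicate n v))"
      unfolding Nt_append_map_Tm_eq by auto
    from X(1) consider "\<gamma> = map Tm u @ [Nt 0] @ map Tm v" | "\<gamma> = map Tm w"
      by (auto simp: bracket_productions_def)
    then show ?case
    proof cases
      case 1
      then have "z = ?open (Suc n)"
        using X(3) ab 1 by (simp only: open_Suc)
      then show ?thesis
        by blast
    next
      case 2
      then have "z = ?closed n"
        using X(3) ab by simp
      then show ?thesis
        by blast
    qed
  qed
  have "map Tm z \<noteq> ?open n" for z n
  proof
    assume eq: "map Tm z = ?open n"
    have "Nt (0 :: nat) \<in> set (map Tm z)"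
      unfolding eq by simp
    then show False
      by auto
  qed
  moreover have "inj (Tm :: 'a \<Rightarrow> (nat, 'a) symb)"
    by (rule injI) simp
  ultimately have "\<exists>n. z = concat (replicate n u) @ w @ concat (replicate n v)"
    if "(derive_step ?P)\<^sup>*\<^sup>* [Nt 0] (map Tm z)" for z
    using shape[OF that] by (simp only: inj_map_eq_map simp_thms)
  then show ?thesis
    using closed unfolding language_of_def by blast
qed

text \<open>Conjugation by \<open>t = (1, \<one>)\<close> acts as \<open>\<phi>\<close> on the base
  group, so \<open>t^-n g t^n\<close> evaluates to the \<open>n\<close>-th point of the orbit. Words
  for \<open>t^-1\<close>, \<open>g\<close> and \<open>t\<close> over \<open>B\<close> serve as
  \<open>u\<close>, \<open>w\<close> and \<open>v\<close>.\<close>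

lemma (in group) orbit_in_Alg_semidirect:
  assumes "\<phi> \<in> auto G" "g \<in> carrier G" "finite_generating_set (semidirect G \<phi>) B"
  shows "base_embed ` range (\<lambda>n. (\<phi> ^^ n) g) \<in> Alg (semidirect G \<phi>) B"
proof -
  let ?H = "semidirect G \<phi>"
  interpret H: group ?H
    using assms(1) by (rule group_semidirect)
  have B: "B \<subseteq> carrier ?H" "generate ?H B = carrier ?H"
    using assms(3) by (auto simp: finite_generating_set_def)
  have t: "(1, \<one>) \<in> carrier ?H"
    by (simp add: semidirect_def)
  have orbit: "(\<phi> ^^ n) g \<in> carrier G" for n
    by (induction n) (auto simp: assms auto_closed)
  have a: "base_embed ((\<phi> ^^ n) g) \<in> carrier ?H" for n
    using orbit by (simp add: semidirect_def base_embed_def)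
  note word = H.generate_word_val[OF B(1), unfolded B(2)]
  obtain u where u: "u \<in> lists (letters B)" "word_val ?H u = inv\<^bsub>?H\<^esub> (1, \<one>)"
    using word[OF H.inv_closed[OF t]] by blast
  obtain v where v: "v \<in> lists (letters B)" "word_val ?H v = (1, \<one>)"
    using word[OF t] by blast
  obtain w where w: "w \<in> lists (letters B)" "word_val ?H w = base_embed g"
    using word[OF a[of 0]] by auto
  define z where "z n = concat (replicate n u) @ w @ concat (replicate n v)" for n
  \<comment> \<open>Here the new pair is split off at the outer ends, so that the induction step is
    one conjugation of the previous value.\<close>
  have z_Suc: "z (Suc n) = u @ z n @ v" for n
    unfolding z_def concat_replicate_Suc_right[of n v] by simp
  have z: "z n \<in> lists (letters B)" for n
    by (induction n) (use u v w in \<open>auto simp: z_Suc, auto simp: z_def\<close>)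
  have val: "word_val ?H (z n) = base_embed ((\<phi> ^^ n) g)" for n
  proof (induction n)
    case 0
    show ?case
      using w by (simp add: z_def)
  next
    case (Suc n)
    have "word_val ?H (z (Suc n)) = word_val ?H u \<otimes>\<^bsub>?H\<^esub> (word_val ?H (z n) \<otimes>\<^bsub>?H\<^esub> word_val ?H v)"
      using H.word_val_append[OF B(1)] u(1) v(1) z[of n] by (simp add: z_Suc)
    also have "\<dots> = inv\<^bsub>?H\<^esub> (1, \<one>) \<otimes>\<^bsub>?H\<^esub> base_embed ((\<phi> ^^ n) g) \<otimes>\<^bsub>?H\<^esub> (1, \<one>)"
      using H.m_assoc[OF H.inv_closed[OF t] a t] by (simp only: Suc u(2) v(2))
    finally show ?case
      using semidirect_relation[OF assms(1) orbit] by simp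
  qed
  have "context_free (range z)"
    unfolding context_free_def z_def
    by (intro exI[of _ "bracket_productions u w v"] exI[of _ 0])
       (simp add: language_of_bracket_productions, simp add: bracket_productions_def)
  moreover have "word_val ?H ` range z = base_embed ` range (\<lambda>n. (\<phi> ^^ n) g)"
    using val by (auto simp: image_image)
  ultimately show ?thesis
    unfolding Alg_def using z by blast
qed

section \<open>Growth of the orbit of \<open>axis 1 1\<close> under \<open>Q_aut\<close>\<close>

lemma Q_orbit_nonneg:
  "1 \<le> (Q_aut ^^ n) (axis 1 1) $ 1 \<and> 0 \<le> (Q_aut ^^ n) (axis 1 1) $ 2"
  by (induction n) (auto simp: Q_aut_nth, auto simp: axis_def)

text \<open>One step sends the first coordinate \<open>x\<close> to \<open>2 * x + y\<close> with
  \<open>y\<close> nonnegative.\<close>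

lemma Q_orbit_doubles:
  assumes "i < j"
  shows "2 * (Q_aut ^^ i) (axis 1 1) $ 1 \<le> (Q_aut ^^ j) (axis 1 1) $ 1"
  using assms
proof (induction j)
  case (Suc j)
  have "2 * (Q_aut ^^ j) (axis 1 1) $ 1 \<le> (Q_aut ^^ Suc j) (axis 1 1) $ 1"
    using Q_orbit_nonneg[of j] by (simp add: Q_aut_nth)
  then show ?case
    using Suc Q_orbit_nonneg[of j] by (cases "i = j") auto
qed simp

lemma inj_Q_orbit: "inj (\<lambda>n. (Q_aut ^^ n) (axis 1 1) $ 1)"
proof (rule injI)
  fix i j
  assume "(Q_aut ^^ i) (axis 1 1) $ 1 = (Q_aut ^^ j) (axis 1 1) $ 1"
  then show "i = j"
    using Q_orbit_doubles[of i j] Q_orbit_doubles[of j i] Q_orbit_nonneg[of i]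
    by (cases i j rule: linorder_cases) auto
qed

text \<open>The first coordinates satisfy \<open>?x i + ?x l = 2 * ?x j\<close>. An outer index
  above \<open>j\<close> makes the left side too large, since one term is at least
  \<open>2 * ?x j\<close> and the other is positive. If \<open>i < j\<close> and
  \<open>l \<le> j\<close>, doubling makes it too small. Hence \<open>i = j\<close>.\<close>

lemma Q_orbit_no_progression:
  assumes "p \<in> range (\<lambda>n. (Q_aut ^^ n) (axis 1 1))" "p + d \<in> range (\<lambda>n. (Q_aut ^^ n) (axis 1 1))"
    "p + d + d \<in> range (\<lambda>n. (Q_aut ^^ n) (axis 1 1))"
  shows "d = 0"
proof -
  let ?x = "\<lambda>n. (Q_aut ^^ n) (axis 1 1) $ 1"
  obtain i j l where ijl: "p = (Q_aut ^^ i) (axis 1 1)" "p + d = (Q_aut ^^ j) (axis 1 1)"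
    "p + d + d = (Q_aut ^^ l) (axis 1 1)"
    using assms by blast
  have sum: "?x i + ?x l = 2 * ?x j"
    unfolding ijl[symmetric] by simp
  have "\<not> j < i"
    using Q_orbit_doubles[of j i] sum Q_orbit_nonneg[of l] by auto
  moreover have "\<not> j < l"
    using Q_orbit_doubles[of j l] sum Q_orbit_nonneg[of i] by auto
  moreover have "\<not> (i < j \<and> l \<le> j)"
    using Q_orbit_doubles[of i j] Q_orbit_doubles[of l j] sum Q_orbit_nonneg[of i]
      Q_orbit_nonneg[of l] by (cases "l = j") auto
  ultimately have "p = p + d"
    using ijl by (metis linorder_neqE_nat not_less)
  then show ?thesis
    by simp
qed

theorem mainTheorem2:
  fixes A :: "(int ^ 2) set" and B :: "(int \<times> (int ^ 2)) set"
  assumes "finite_generating_set Z2 A"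
    and "finite_generating_set (semidirect Z2 Q_aut) B"
  shows "Alg Z2 A \<noteq> {K. K \<subseteq> carrier Z2 \<and> base_embed ` K \<in> Alg (semidirect Z2 Q_aut) B}"
proof -
  interpret group Z2
    by (rule group_Z2)
  define K where "K = range (\<lambda>n. (Q_aut ^^ n) (axis 1 1))"
  have "base_embed ` K \<in> Alg (semidirect Z2 Q_aut) B"
    unfolding K_def by (rule orbit_in_Alg_semidirect[OF Q_aut_auto _ assms(2)]) (simp add: Z2_def)
  moreover have "K \<notin> Alg Z2 A"
  proof
    assume "K \<in> Alg Z2 A"
    then obtain L where L: "context_free L" "(\<lambda>w. sum_list (map (letter_val Z2) w)) ` L = K"
      by (auto simp: Alg_def word_val_Z2 cong: image_cong)
    \<comment> \<open>Infinity is read off the first coordinate, which is injective in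
      \<open>n\<close> along the orbit.\<close>
    have "infinite ((\<lambda>v. v $ 1) ` K)"
      unfolding K_def image_image using inj_Q_orbit by (rule range_inj_infinite)
    then have "infinite K"
      by blast
    then obtain p d where "d \<noteq> 0" "p \<in> K" "p + d \<in> K" "p + d + d \<in> K"
      using infinite_context_free_values_progression[OF L] by metis
    then show False
      using Q_orbit_no_progression unfolding K_def by blast
  qed
  moreover have "K \<subseteq> carrier Z2"
    by (simp add: Z2_def)
  ultimately show ?thesis
    by blast
qed

end
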